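(* There exist finite solvable groups $G$ and $H$ such that $n(\Gamma_{\mathbb{R}}(G))=3$ and $n(\Gamma_{\mathbb{R}}(H))=4$.
   Context: An element $x$ of a finite group $G$ is real if there exists $g\in G$ with $g^{-1}xg=x^{-1}$. The real prime graph $\Gamma_{\mathbb{R}}(G)$ of a finite group $G$ is the graph whose vertices are the primes $p$ such that $G$ contains a real element of order $p$, and in which two distinct vertices $p$ and $q$ are joined by an edge if and only if $G$ contains a real element of order $pq$. For a graph $\Gamma$, $n(\Gamma)$ denotes the number of connected components of $\Gamma$. *)

theory Defs
  imports "HOL-Algebra.Algebra" "Graph_Theory.Graph_Theory" "HOL-Computational_Algebra.Primes"
begin

definition real_element :: "('a, 'b) monoid_scheme \<Rightarrow> 'a \<Rightarrow> bool" where
  "real_element G x \<longleftrightarrow>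
     x \<in> carrier G \<and> (\<exists>g\<in>carrier G. inv\<^bsub>G\<^esub> g \<otimes>\<^bsub>G\<^esub> x \<otimes>\<^bsub>G\<^esub> g = inv\<^bsub>G\<^esub> x)"

definition real_prime_vertices :: "('a, 'b) monoid_scheme \<Rightarrow> nat set" where
  "real_prime_vertices G = {p. Factorial_Ring.prime p \<and> (\<exists>x. real_element G x \<and> group.ord G x = p)}"

text \<open>
  An undirected edge is encoded by the two arcs \<open>(p, q)\<close> and \<open>(q, p)\<close>.
\<close>

definition real_prime_graph :: "('a, 'b) monoid_scheme \<Rightarrow> nat pair_pre_digraph" where
  "real_prime_graph G =
     \<lparr> pverts = real_prime_vertices G,
       parcs = {(p, q). p \<in> real_prime_vertices G \<and> q \<in> real_prime_vertices G \<and> p \<noteq> q \<and>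
                        (\<exists>x. real_element G x \<and> group.ord G x = p * q)} \<rparr>"

definition num_components :: "'a pair_pre_digraph \<Rightarrow> nat" where
  "num_components \<Gamma> = card {C. pre_digraph.max_subgraph (with_proj \<Gamma>) Digraph_Component.connected C}"

lemma pair_graph_real_prime_graph:
  assumes "group G" "finite (carrier G)"
  shows "pair_graph (real_prime_graph G)"
proof -
  interpret group G by fact
  have "real_prime_vertices G \<subseteq> ord ` carrier G"
    by (auto simp: real_prime_vertices_def real_element_def)
  then have fin: "finite (real_prime_vertices G)"
    using assms(2) finite_surj by blast
  have "parcs (real_prime_graph G) \<subseteq> real_prime_vertices G \<times> real_prime_vertices G"
    by (auto simp: real_prime_graph_def)
  with fin have fin': "finite (parcs (real_prime_graph G))"
    using finite_subset by blast
  show ?thesis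
    using fin fin'
    by unfold_locales
       (auto simp: real_prime_graph_def Digraph.symmetric_def sym_def mult.commute)
qed

lemma num_components_eq_card_sccs:
  assumes "pair_sym_digraph \<Gamma>"
  shows "num_components \<Gamma> = card (pre_digraph.sccs (with_proj \<Gamma>))"
proof -
  let ?G = "with_proj \<Gamma>"
  interpret pair_sym_digraph \<Gamma> by fact
  have conn: "Digraph_Component.connected H" if "strongly_connected H" "subgraph H ?G" for H
  proof -
    interpret H: wf_digraph H using that(2) by auto
    show ?thesis
      using that(1) H.reachable_mk_symmetricI
      by (auto simp: Digraph_Component.connected_def strongly_connected_def)
  qed
  have closure: "strongly_connected (?G \<restriction> verts H)" "subgraph H (?G \<restriction> verts H)"
      "subgraph (?G \<restriction> verts H) ?G"
    if H: "Digraph_Component.connected H" "subgraph H ?G" for H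
  proof -
    interpret I: wf_digraph "?G \<restriction> verts H" by (rule wellformed_induce_subgraph)
    have ind: "induced_subgraph (?G \<restriction> verts H) ?G"
      using subgraph_imp_subverts[OF H(2)] by (intro induced_induce) auto
    then show "subgraph (?G \<restriction> verts H) ?G" by auto
    show sub: "subgraph H (?G \<restriction> verts H)"
    proof (rule subgraphI)
      from H(2) interpret wfH: wf_digraph H by auto
      have ends: "tail H = fst" "head H = snd"
        using H(2) by (auto simp: subgraph_def compatible_def)
      show "arcs H \<subseteq> arcs (?G \<restriction> verts H)"
        using H(2) wfH.tail_in_verts wfH.head_in_verts by (auto simp: subgraph_def ends)
      show "compatible (?G \<restriction> verts H) H"
        by (simp add: compatible_def ends)
      show "wf_digraph H" ..
      show "wf_digraph (?G \<restriction> verts H)" ..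
    qed simp
    then have "Digraph_Component.connected (?G \<restriction> verts H)"
      using H(1) by (intro I.connected_spanning_imp_connected[of H]) (auto simp: spanning_def)
    moreover have "symmetric (?G \<restriction> verts H)"
      using induced_graph_imp_symmetric[OF _ ind] pair_sym_arcs by blast
    ultimately show "strongly_connected (?G \<restriction> verts H)"
      by (intro I.symmetric_connected_imp_strongly_connected)
  qed
  have antisym: "H = H'" if "subgraph H H'" "subgraph H' H" for H H' :: "('a, 'a \<times> 'a) pre_digraph"
    using that by (auto simp: subgraph_def compatible_def intro!: pre_digraph.equality)
  have "max_subgraph Digraph_Component.connected H \<longleftrightarrow> max_subgraph strongly_connected H" for H
  proof
    assume "max_subgraph Digraph_Component.connected H"
    then have H: "subgraph H ?G" "Digraph_Component.connected H"
      and max: "\<And>K. subgraph H K \<Longrightarrow> subgraph K ?G \<Longrightarrow> Digraph_Component.connected K \<Longrightarrow> K = H"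
      unfolding max_subgraph_def by blast+
    have "?G \<restriction> verts H = H"
      using max closure[OF H(2,1)] conn by blast
    then have "strongly_connected H"
      using closure(1)[OF H(2,1)] by simp
    with H(1) max conn show "max_subgraph strongly_connected H"
      unfolding max_subgraph_def by blast
  next
    assume "max_subgraph strongly_connected H"
    then have H: "subgraph H ?G" "strongly_connected H"
      and max: "\<And>K. subgraph H K \<Longrightarrow> subgraph K ?G \<Longrightarrow> strongly_connected K \<Longrightarrow> K = H"
      unfolding max_subgraph_def by blast+
    have "K = H" if K: "subgraph H K" "subgraph K ?G" "Digraph_Component.connected K" for K
    proof -
      note cl = closure[OF K(3,2)]
      have "?G \<restriction> verts K = H"
        using max[OF subgraph_trans[OF K(1) cl(2)] cl(3,1)] .
      then have "subgraph K H" using cl(2) by simp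
      then show ?thesis using antisym K(1) by blast
    qed
    then show "max_subgraph Digraph_Component.connected H"
      using H conn unfolding max_subgraph_def by blast
  qed
  then show ?thesis
    by (simp add: num_components_def sccs_altdef2)
qed

end

theory Submission
  imports Defs "HOL-Library.Numeral_Type"
begin

text \<open>
  Let \<open>F\<close> be a group all of whose elements have odd order, so that only \<open>1\<close> is conjugate to its
  inverse in \<open>F\<close>. The orders of real elements of the wreath product \<open>F wr S\<^sub>3\<close> are exactly the orders of
  elements of \<open>F\<close>, together with \<open>2\<close> and \<open>3\<close>. Indeed, an element inverting \<open>(f\<^sub>1, f\<^sub>2, f\<^sub>3)\<close> permutes
  the coordinates by some \<open>q\<close> and makes the entry at \<open>q i\<close> conjugate to the inverse of the entry at \<open>i\<close>;
  hence entries on cycles of odd length are trivial, and one element order remains. If \<open>x\<close> is real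
  and lies over a permutation \<open>p \<noteq> 1\<close> of order \<open>m\<close>, then \<open>x\<^sup>m\<close> has conjugate entries along each
  \<open>p\<close>-orbit, and an element inverting \<open>x\<close> preserves those orbits, so every entry of \<open>x\<^sup>m\<close> is conjugate
  to its inverse and \<open>x\<^sup>m = 1\<close>.

  The cyclic group of order \<open>5\<close> gives real orders \<open>{1, 2, 3, 5}\<close>, and the Frobenius group of order \<open>55\<close>
  gives \<open>{1, 2, 3, 5, 11}\<close>: in both graphs every component is a single vertex.
\<close>

section \<open>Orders of real elements\<close>

text \<open>The real prime graph depends on the group only through this set, so all later
  computations are about it.\<close>

definition real_orders :: "('a, 'b) monoid_scheme \<Rightarrow> nat set" where
  "real_orders G = group.ord G ` Collect (real_element G)"

lemma real_ordersI:
  assumes "real_element G x" "group.ord G x = n"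
  shows "n \<in> real_orders G"
  using assms by (auto simp: real_orders_def)

lemma real_prime_vertices_eq: "real_prime_vertices G = {p \<in> real_orders G. Factorial_Ring.prime p}"
  by (auto simp: real_prime_vertices_def real_orders_def)

lemma real_prime_graph_eq:
  "real_prime_graph G =
     \<lparr> pverts = {p \<in> real_orders G. Factorial_Ring.prime p},
       parcs = {(p, q). p \<in> real_orders G \<and> Factorial_Ring.prime p \<and>
                        q \<in> real_orders G \<and> Factorial_Ring.prime q \<and>
                        p \<noteq> q \<and> p * q \<in> real_orders G} \<rparr>"
proof -
  have "n \<in> real_orders G \<longleftrightarrow> (\<exists>x. real_element G x \<and> group.ord G x = n)" for n
    by (auto simp: real_orders_def)
  then show ?thesis
    by (auto simp: real_prime_graph_def real_prime_vertices_eq)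
qed

text \<open>Clearing inverses gives an equation that passes through homomorphisms and powers and can
  be compared entry by entry in a wreath product.\<close>

lemma (in group) real_element_iff:
  "real_element G x \<longleftrightarrow> x \<in> carrier G \<and> (\<exists>y\<in>carrier G. x \<otimes> y \<otimes> x = y)"
proof -
  have "inv y \<otimes> x \<otimes> y = inv x \<longleftrightarrow> x \<otimes> y \<otimes> x = y" if "x \<in> carrier G" "y \<in> carrier G" for y
    using that inv_solve_left[of "inv x" y "x \<otimes> y"] inv_solve_right[of "x \<otimes> y" y x]
    by (auto simp: m_assoc)
  then show ?thesis
    by (auto simp: real_element_def)
qed

text \<open>In the inductive step the innermost \<open>x \<otimes> y \<otimes> x\<close> collapses
  to \<open>y\<close>. It is used to pass from a real element of the wreath product to a power lying
  in the base group.\<close>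

lemma (in monoid) inverted_pow:
  assumes "x \<in> carrier G" "y \<in> carrier G" "x \<otimes> y \<otimes> x = y"
  shows "x [^] (n::nat) \<otimes> y \<otimes> x [^] n = y"
proof (induction n)
  case (Suc n)
  have unfold_left: "x [^] Suc n = x [^] n \<otimes> x" and unfold_right: "x \<otimes> x [^] n = x [^] Suc n"
    using nat_pow_Suc2[OF assms(1), of n] by simp_all
  have "x [^] Suc n \<otimes> y \<otimes> x [^] Suc n = x [^] n \<otimes> x \<otimes> y \<otimes> (x \<otimes> x [^] n)"
    unfolding unfold_right unfold_left by (rule refl)
  also have "\<dots> = x [^] n \<otimes> (x \<otimes> y \<otimes> x) \<otimes> x [^] n"
    using assms(1,2) by (simp add: m_assoc)
  finally have "x [^] Suc n \<otimes> y \<otimes> x [^] Suc n = x [^] n \<otimes> (x \<otimes> y \<otimes> x) \<otimes> x [^] n" .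
  with Suc show ?case
    by (simp add: assms(3))
qed (use assms in simp)

lemma (in group) ord_eq_prime:
  assumes "x \<in> carrier G" "x \<noteq> \<one>" "x [^] p = \<one>" "Factorial_Ring.prime p"
  shows "ord x = p"
  using assms pow_eq_id[of x p] ord_eq_1[of x] by (auto simp: prime_nat_iff)

lemma real_orders_iso_subset:
  assumes "group G" "group H" "h \<in> iso G H"
  shows "real_orders G \<subseteq> real_orders H"
proof
  interpret group_hom G H h
    using assms by (simp add: group_hom_def group_hom_axioms_def iso_def)
  fix n assume "n \<in> real_orders G"
  then obtain x where x: "real_element G x" "n = G.ord x"
    by (auto simp: real_orders_def)
  then obtain y where xy: "x \<in> carrier G" "y \<in> carrier G" "x \<otimes>\<^bsub>G\<^esub> y \<otimes>\<^bsub>G\<^esub> x = y"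
    by (auto simp: G.real_element_iff)
  have "h x \<otimes>\<^bsub>H\<^esub> h y \<otimes>\<^bsub>H\<^esub> h x = h y"
    using xy by (metis G.m_closed hom_mult)
  then have "real_element H (h x)"
    using xy by (auto simp: H.real_element_iff)
  moreover have "H.ord (h x) = G.ord x"
  proof -
    have inj: "inj_on h (carrier G)"
      using assms(3) by (simp add: iso_def bij_betw_def)
    have "h x [^]\<^bsub>H\<^esub> k = \<one>\<^bsub>H\<^esub> \<longleftrightarrow> x [^]\<^bsub>G\<^esub> k = \<one>\<^bsub>G\<^esub>" for k :: nat
      using xy inj by (metis G.nat_pow_closed G.one_closed hom_nat_pow hom_one inj_on_eq_iff)
    then show ?thesis
      using xy by (simp add: H.ord_unique G.pow_eq_id)
  qed
  ultimately show "n \<in> real_orders H"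
    using x(2) by (intro real_ordersI) simp_all
qed

lemma real_orders_iso:
  assumes "group G" "group H" "h \<in> iso G H"
  shows "real_orders G = real_orders H"
  using real_orders_iso_subset[OF assms]
    real_orders_iso_subset[OF assms(2,1) group.iso_set_sym[OF assms(1,3)]]
  by (rule subset_antisym)

text \<open>The final theorem speaks of groups on \<open>nat\<close>, whereas the wreath products
  live on function types. An injection into \<open>nat\<close> transports the structure.\<close>

lemma finite_group_nat_copy:
  assumes "group G" "finite (carrier G)" "solvable G"
  obtains K :: "nat monoid"
  where "group K" "finite (carrier K)" "solvable K" "real_orders K = real_orders G"
proof -
  obtain h :: "'a \<Rightarrow> nat" where h: "inj_on h (carrier G)"
    using assms(2) finite_imp_inj_to_nat_seg by metis
  interpret group G by fact
  define K where "K = image_group h G"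
  have K: "group K"
    using inj_imp_image_group_is_group[OF h] by (simp add: K_def)
  have iso: "h \<in> iso G K"
    using inj_imp_image_group_iso[OF h] by (simp add: K_def)
  interpret group_hom G K h
    using iso K by (simp add: group_hom_def group_hom_axioms_def iso_def is_group)
  have surj: "h ` carrier G = carrier K"
    using iso by (simp add: iso_def bij_betw_def)
  have "finite (carrier K)"
    using assms(2) surj by (metis finite_imageI)
  moreover have "solvable K"
    by (rule surj_hom_imp_solvable[OF surj assms(3)])
  moreover have "real_orders K = real_orders G"
    by (rule real_orders_iso[OF assms(1) K iso, symmetric])
  ultimately show thesis
    by (rule that[OF K])
qed

text \<open>Without arcs each vertex reaches only itself, so the strong components are singletons;
  the arc relation is trivially symmetric, so these count the components.\<close>

lemma num_components_discrete:
  assumes "finite (pverts \<Gamma>)" "parcs \<Gamma> = {}"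
  shows "num_components \<Gamma> = card (pverts \<Gamma>)"
proof -
  interpret pair_graph \<Gamma>
    using assms by unfold_locales (auto simp: Digraph.symmetric_def sym_def)
  have reach: "u \<rightarrow>\<^sup>*\<^bsub>with_proj \<Gamma>\<^esub> v \<longleftrightarrow> u = v \<and> u \<in> pverts \<Gamma>" for u v
    using assms(2) by (auto elim: converse_reachable_cases)
  have verts: "pre_digraph.sccs_verts (with_proj \<Gamma>) = (\<lambda>v. {v}) ` pverts \<Gamma>"
  proof (intro equalityI subsetI)
    fix S assume "S \<in> pre_digraph.sccs_verts (with_proj \<Gamma>)"
    then have "S \<noteq> {}" "\<forall>u\<in>S. \<forall>v\<in>S. u = v \<and> u \<in> pverts \<Gamma>"
      by (auto simp: pre_digraph.sccs_verts_def reach)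
    then obtain v where "v \<in> S" "\<forall>u\<in>S. u = v" "v \<in> pverts \<Gamma>"
      by blast
    then have "S = {v}" "v \<in> pverts \<Gamma>"
      by blast+
    then show "S \<in> (\<lambda>v. {v}) ` pverts \<Gamma>"
      by blast
  next
    fix S assume "S \<in> (\<lambda>v. {v}) ` pverts \<Gamma>"
    then show "S \<in> pre_digraph.sccs_verts (with_proj \<Gamma>)"
      by (auto simp: pre_digraph.sccs_verts_def reach)
  qed
  have "card (pre_digraph.sccs (with_proj \<Gamma>)) = card (pverts \<Gamma>)"
    by (simp flip: card_sccs_verts add: verts card_image)
  then show ?thesis
    using num_components_eq_card_sccs[of \<Gamma>] pair_sym_digraph_axioms by simp
qed

text \<open>An edge would need a product of two primes among the real orders, but such a product is
  neither \<open>1\<close> nor prime. Hence the graph is discrete.\<close>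

lemma num_components_prime_real_orders:
  assumes "finite P" "\<And>p. p \<in> P \<Longrightarrow> Factorial_Ring.prime p" "real_orders G = insert 1 P"
  shows "num_components (real_prime_graph G) = card P"
proof -
  have "pverts (real_prime_graph G) = P"
    using assms(2,3) by (auto simp: real_prime_graph_eq)
  moreover have "parcs (real_prime_graph G) = {}"
  proof -
    have "(p, q) \<notin> parcs (real_prime_graph G)" for p q
    proof
      assume "(p, q) \<in> parcs (real_prime_graph G)"
      then have pq: "Factorial_Ring.prime p" "Factorial_Ring.prime q" "p * q \<in> insert 1 P"
        by (simp_all add: real_prime_graph_eq assms(3))
      then have "p \<noteq> 1" "q \<noteq> 1"
        by auto
      then have "p * q \<in> P"
        using pq(3) by simp
      then show False
        using prime_product[OF assms(2)] \<open>p \<noteq> 1\<close> \<open>q \<noteq> 1\<close> by blast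
    qed
    then show ?thesis
      by auto
  qed
  ultimately show ?thesis
    using assms(1) num_components_discrete[of "real_prime_graph G"] by simp
qed

section \<open>Conjugacy in groups of odd order\<close>

context group
begin

text \<open>The inverse-free equation is the shape in which entries of wreath product identities
  appear; membership is included so that chains of conjugacies carry it along.\<close>

definition conjugate :: "'a \<Rightarrow> 'a \<Rightarrow> bool" where
  "conjugate a b \<longleftrightarrow> a \<in> carrier G \<and> b \<in> carrier G \<and> (\<exists>u\<in>carrier G. a \<otimes> u = u \<otimes> b)"

lemma conjugate_refl: "a \<in> carrier G \<Longrightarrow> conjugate a a"
  unfolding conjugate_def by (intro conjI bexI[of _ \<one>]) simp_all

lemma conjugate_trans:
  assumes "conjugate a b" "conjugate b c"
  shows "conjugate a c"
proof -
  obtain u v where *: "u \<in> carrier G" "v \<in> carrier G" "a \<otimes> u = u \<otimes> b" "b \<otimes> v = v \<otimes> c"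
      "a \<in> carrier G" "b \<in> carrier G" "c \<in> carrier G"
    using assms by (auto simp: conjugate_def)
  have "a \<otimes> (u \<otimes> v) = a \<otimes> u \<otimes> v"
    using *(1,2,5-7) by (simp add: m_assoc)
  also have "\<dots> = u \<otimes> (b \<otimes> v)"
    unfolding *(3) using *(1,2,5-7) by (simp add: m_assoc)
  also have "\<dots> = u \<otimes> v \<otimes> c"
    unfolding *(4) using *(1,2,5-7) by (simp add: m_assoc)
  finally have "a \<otimes> (u \<otimes> v) = u \<otimes> v \<otimes> c" .
  with * show ?thesis
    unfolding conjugate_def by blast
qed

lemma conjugate_sym:
  assumes "conjugate a b"
  shows "conjugate b a"
proof -
  obtain u where u: "u \<in> carrier G" "a \<otimes> u = u \<otimes> b" and ab: "a \<in> carrier G" "b \<in> carrier G"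
    using assms by (auto simp: conjugate_def)
  have "b = inv u \<otimes> (a \<otimes> u)"
    using u ab by (simp add: m_assoc[symmetric])
  then have "b \<otimes> inv u = inv u \<otimes> a"
    using u(1) ab by (simp add: m_assoc)
  with u ab show ?thesis
    unfolding conjugate_def by blast
qed

lemma conjugate_inv:
  assumes "conjugate a b"
  shows "conjugate (inv a) (inv b)"
proof -
  obtain u where u: "u \<in> carrier G" "a \<otimes> u = u \<otimes> b" and ab: "a \<in> carrier G" "b \<in> carrier G"
    using assms by (auto simp: conjugate_def)
  have "a \<otimes> (u \<otimes> inv b) = (a \<otimes> u) \<otimes> inv b"
    using u(1) ab by (simp add: m_assoc)
  also have "\<dots> = u"
    unfolding u(2) using u(1) ab by (simp add: m_assoc)
  finally have "inv a \<otimes> u = u \<otimes> inv b"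
    using u(1) ab by (simp add: inv_solve_left')
  with u ab show ?thesis
    unfolding conjugate_def by blast
qed

lemma conjugate_pow_one:
  assumes "conjugate a b" "b [^] n = \<one>"
  shows "a [^] (n::nat) = \<one>"
proof -
  obtain u where u: "u \<in> carrier G" "a \<otimes> u = u \<otimes> b" and ab: "a \<in> carrier G" "b \<in> carrier G"
    using assms by (auto simp: conjugate_def)
  have "a [^] k \<otimes> u = u \<otimes> b [^] k" for k :: nat
  proof (induction k)
    case (Suc k)
    have "a [^] Suc k \<otimes> u = a [^] k \<otimes> (a \<otimes> u)"
      using u(1) ab by (simp add: m_assoc)
    also have "\<dots> = a [^] k \<otimes> u \<otimes> b"
      unfolding u(2) using u(1) ab by (simp add: m_assoc)
    also have "\<dots> = u \<otimes> b [^] Suc k"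
      unfolding Suc using u(1) ab by (simp add: m_assoc)
    finally show ?case .
  qed (use u(1) in simp)
  then have "a [^] n \<otimes> u = u"
    using assms(2) u(1) by simp
  then show ?thesis
    using u(1) ab by simp
qed

lemma ord_conjugate:
  assumes "conjugate a b"
  shows "ord a = ord b"
proof -
  have "a [^] n = \<one> \<longleftrightarrow> b [^] n = \<one>" for n :: nat
    using conjugate_pow_one[OF assms] conjugate_pow_one[OF conjugate_sym[OF assms]] by blast
  then show ?thesis
    using assms by (simp add: ord_unique pow_eq_id conjugate_def)
qed

text \<open>If \<open>u\<close> inverts \<open>a\<close>, then even powers of \<open>u\<close>
  centralize \<open>a\<close> while odd powers invert it. As \<open>u\<close> has odd order, the
  trivial power is an odd one, so \<open>a\<close> equals its inverse, and odd order then forces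
  \<open>a = \<one>\<close>.\<close>

lemma conjugate_inv_odd:
  assumes "conjugate a (inv a)" and odd: "\<And>u. u \<in> carrier G \<Longrightarrow> odd (ord u)"
  shows "a = \<one>"
proof -
  obtain u where u: "u \<in> carrier G" "a \<otimes> u = u \<otimes> inv a" and a: "a \<in> carrier G"
    using assms(1) by (auto simp: conjugate_def)
  have u': "inv a \<otimes> u = u \<otimes> a"
  proof -
    have "a \<otimes> (u \<otimes> a) = (a \<otimes> u) \<otimes> a"
      using u(1) a by (simp add: m_assoc)
    also have "\<dots> = u"
      unfolding u(2) using u(1) a by (simp add: m_assoc)
    finally show ?thesis
      using u(1) a by (simp add: inv_solve_left')
  qed
  have even: "a \<otimes> u [^] (2 * k) = u [^] (2 * k) \<otimes> a" for k :: nat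
  proof (induction k)
    case (Suc k)
    have "a \<otimes> u [^] (2 * Suc k) = a \<otimes> u [^] (2 * k) \<otimes> u \<otimes> u"
      using u(1) a by (simp add: m_assoc)
    also have "\<dots> = u [^] (2 * k) \<otimes> (a \<otimes> u) \<otimes> u"
      using u(1) a Suc by (simp add: m_assoc)
    also have "\<dots> = u [^] (2 * k) \<otimes> u \<otimes> (inv a \<otimes> u)"
      unfolding u(2) using u(1) a by (simp add: m_assoc)
    also have "\<dots> = u [^] (2 * Suc k) \<otimes> a"
      unfolding u' using u(1) a by (simp add: m_assoc)
    finally show ?case .
  qed (use a in simp)
  obtain k where k: "ord u = 2 * k + 1"
    using odd[OF u(1)] by (rule oddE)
  have one: "u [^] (2 * k) \<otimes> u = \<one>"
    using pow_ord_eq_1[OF u(1)] by (simp add: k)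
  \<comment> \<open>Move \<open>a\<close> through the trivial product: it commutes with
    \<open>u [^] (2 * k)\<close>, and the last factor \<open>u\<close> turns it into its
    inverse.\<close>
  have "a = a \<otimes> (u [^] (2 * k) \<otimes> u)"
    using a by (simp add: one)
  also have "\<dots> = u [^] (2 * k) \<otimes> (a \<otimes> u)"
    using a u(1) even[of k] by (simp add: m_assoc[symmetric])
  also have "\<dots> = u [^] (2 * k) \<otimes> u \<otimes> inv a"
    unfolding u(2) using a u(1) by (simp add: m_assoc)
  also have "\<dots> = inv a"
    using a by (simp add: one)
  finally have "a = inv a" .
  then have "a \<otimes> a = \<one>"
    using a r_inv[of a] by simp
  then have "ord a dvd 2"
    using a by (simp add: pow_eq_id[symmetric] numeral_2_eq_2)
  with odd[OF a] have "ord a = 1"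
    by (metis dvd_refl prime_nat_iff two_is_prime_nat)
  then show ?thesis
    using a ord_eq_1 by blast
qed

end

section \<open>Affine groups\<close>

text \<open>The pair \<open>(a, b)\<close> stands for the map sending \<open>x\<close> to
  \<open>a * x + b\<close>, and the product is composition of maps.\<close>

definition affine_group :: "'a::comm_ring_1 set \<Rightarrow> ('a \<times> 'a) monoid" where
  "affine_group U =
     \<lparr> carrier = U \<times> UNIV, monoid.mult = (\<lambda>(a, b) (c, d). (a * c, a * d + b)), monoid.one = (1, 0) \<rparr>"

locale unit_group =
  fixes U :: "'a::comm_ring_1 set"
  assumes one_mem: "1 \<in> U"
    and mult_mem: "\<lbrakk>a \<in> U; b \<in> U\<rbrakk> \<Longrightarrow> a * b \<in> U"
    and inverse_mem: "a \<in> U \<Longrightarrow> \<exists>b\<in>U. b * a = 1"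
begin

lemma carrier_affine: "carrier (affine_group U) = U \<times> UNIV"
  by (simp add: affine_group_def)

lemma mult_affine: "(a, b) \<otimes>\<^bsub>affine_group U\<^esub> (c, d) = (a * c, a * d + b)"
  by (simp add: affine_group_def)

lemma one_affine: "\<one>\<^bsub>affine_group U\<^esub> = (1, 0)"
  by (simp add: affine_group_def)

lemmas affine_simps = carrier_affine mult_affine one_affine

sublocale affine: group "affine_group U"
proof (rule groupI)
  fix x assume "x \<in> carrier (affine_group U)"
  then obtain a b where x: "x = (a, b)" "a \<in> U"
    by (auto simp: affine_simps)
  then obtain c where "c \<in> U" "c * a = 1"
    using inverse_mem by blast
  then show "\<exists>y\<in>carrier (affine_group U). y \<otimes>\<^bsub>affine_group U\<^esub> x = \<one>\<^bsub>affine_group U\<^esub>"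
    using x by (intro bexI[of _ "(c, - (c * b))"]) (auto simp: affine_simps)
qed (auto simp: affine_simps one_mem mult_mem algebra_simps)

text \<open>The geometric sum decides the orders: it is \<open>n\<close> for \<open>a = 1\<close>,
  and it vanishes modulo 11 for \<open>n = 5\<close> and a nontrivial fifth root of unity
  \<open>a\<close>.\<close>

lemma pow_affine:
  "(a, b) [^]\<^bsub>affine_group U\<^esub> (n::nat) = (a ^ n, b * (\<Sum>i<n. a ^ i))"
  by (induction n) (auto simp: affine_simps algebra_simps)

text \<open>The linear parts commute, so every commutator is a translation, and translations commute
  with each other. The second derived subgroup is therefore trivial.\<close>

lemma solvable_affine: "solvable (affine_group U)"
proof -
  let ?A = "affine_group U"
  let ?T = "{1} \<times> (UNIV :: 'a set)"
  have inv: "inv\<^bsub>?A\<^esub> (a, b) = (c, - (c * b))" if "c \<in> U" "a \<in> U" "c * a = 1" for a b c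
    using that by (intro affine.inv_equality) (auto simp: affine_simps)
  have comm: "x \<otimes>\<^bsub>?A\<^esub> y \<otimes>\<^bsub>?A\<^esub> inv\<^bsub>?A\<^esub> x \<otimes>\<^bsub>?A\<^esub> inv\<^bsub>?A\<^esub> y \<in> ?T"
    if xy_carrier: "x \<in> carrier ?A" "y \<in> carrier ?A" for x y
  proof -
    obtain a b c d a' c' where xy: "x = (a, b)" "y = (c, d)" "a \<in> U" "c \<in> U"
        "a' \<in> U" "c' \<in> U" "a' * a = 1" "c' * c = 1"
    proof -
      obtain a b c d where *: "x = (a, b)" "y = (c, d)" "a \<in> U" "c \<in> U"
        using xy_carrier by (cases x; cases y) (auto simp: affine_simps)
      moreover obtain a' c' where "a' \<in> U" "c' \<in> U" "a' * a = 1" "c' * c = 1"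
        using inverse_mem[OF *(3)] inverse_mem[OF *(4)] by blast
      ultimately show ?thesis
        by (rule that)
    qed
    have "a * c * a' * c' = (a' * a) * (c' * c)"
      by (simp only: ac_simps)
    with xy show ?thesis
      by (auto simp: affine_simps inv)
  qed
  have T: "subgroup ?T ?A"
    by unfold_locales (auto simp: affine_simps one_mem inv[of 1])
  have "derived ?A (carrier ?A) \<subseteq> ?T"
    unfolding derived_def
    by (rule affine.generate_subgroup_incl[OF _ T]) (use comm in blast)
  moreover have "derived ?A ?T \<subseteq> {\<one>\<^bsub>?A\<^esub>}"
    unfolding derived_def
    by (intro affine.generate_subgroup_incl[OF _ affine.triv_subgroup])
       (auto simp: affine_simps one_mem inv[of 1])
  ultimately have "derived ?A (derived ?A (carrier ?A)) \<subseteq> {\<one>\<^bsub>?A\<^esub>}"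
    using affine.mono_derived by blast
  then have "(derived ?A ^^ 2) (carrier ?A) = {\<one>\<^bsub>?A\<^esub>}"
    using affine.exp_of_derived_is_subgroup[OF affine.subgroup_self, of 2] subgroup.one_closed
    by (fastforce simp: numeral_2_eq_2)
  then show ?thesis
    using affine.solvable_iff_trivial_derived_seq by blast
qed

end

section \<open>Permutations of three points\<close>

lemma UNIV_3_eq: "(UNIV :: 3 set) = {0, 1, 2}"
  by (rule sym, rule card_subset_eq) auto

lemma exhaust_3: "(i :: 3) = 0 \<or> i = 1 \<or> i = 2"
  using UNIV_3_eq by auto

lemma all_3: "(\<forall>i :: 3. P i) \<longleftrightarrow> P 0 \<and> P 1 \<and> P 2"
  using exhaust_3 by metis

text \<open>Injectivity leaves six tables of values; without the identity there remain two 3-cycles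
  and three transpositions.\<close>

lemma perm_3_cases:
  fixes p :: "3 \<Rightarrow> 3"
  assumes "bij p" "p \<noteq> id"
  obtains (three_cycle) "p ^^ 3 = id" "\<And>a b. \<exists>n. b = (p ^^ n) a"
    | (transposition) i j k where "UNIV = {i, j, k}" "p i = j" "p j = i" "p k = k"
        "i \<noteq> j" "i \<noteq> k" "j \<noteq> k"
proof -
  have "p 0 \<noteq> p 1" "p 0 \<noteq> p 2" "p 1 \<noteq> p 2"
    using bij_is_inj[OF assms(1)] by (auto simp: inj_eq)
  moreover have "\<not> (p 0 = 0 \<and> p 1 = 1 \<and> p 2 = 2)"
    using assms(2) all_3[of "\<lambda>i. p i = i"] by (simp add: fun_eq_iff)
  moreover note exhaust_3[of "p 0"] exhaust_3[of "p 1"] exhaust_3[of "p 2"]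
  ultimately consider "p 0 = 1 \<and> p 1 = 2 \<and> p 2 = 0 \<or> p 0 = 2 \<and> p 1 = 0 \<and> p 2 = 1"
    | "p 0 = 0" "p 1 = 2" "p 2 = 1" | "p 0 = 2" "p 1 = 1" "p 2 = 0" | "p 0 = 1" "p 1 = 0" "p 2 = 2"
    by (elim disjE) simp_all
  then show thesis
  proof cases
    case 1
    then have "\<forall>a. p (p (p a)) = a"
      unfolding all_3 by auto
    then have "p ^^ 3 = id"
      by (simp add: numeral_3_eq_3 fun_eq_iff)
    moreover have "\<exists>n. b = (p ^^ n) a" for a b
    proof -
      have "\<forall>a b. b = a \<or> b = p a \<or> b = p (p a)"
        unfolding all_3 using 1 by auto
      then have "b = (p ^^ 0) a \<or> b = (p ^^ 1) a \<or> b = (p ^^ 2) a"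
        by (simp add: numeral_2_eq_2)
      then show ?thesis by blast
    qed
    ultimately show thesis
      by (rule three_cycle)
  next
    case 2
    then show thesis
      by (intro transposition[of 1 2 0]) (use UNIV_3_eq in auto)
  next
    case 3
    then show thesis
      by (intro transposition[of 0 2 1]) (use UNIV_3_eq in auto)
  next
    case 4
    then show thesis
      by (intro transposition[of 0 1 2]) (use UNIV_3_eq in auto)
  qed
qed

text \<open>The last property says that \<open>q\<close> preserves every \<open>p\<close>-orbit. For
  a 3-cycle there is only one orbit. For a transposition, \<open>q\<close> maps the fixed point
  \<open>k\<close> to a fixed point of \<open>p\<close>, hence to \<open>k\<close>, and so preserves
  the other two points as a set.\<close>

lemma perm_3_inverted:
  fixes p q :: "3 \<Rightarrow> 3"
  assumes "bij p" "bij q" "p \<circ> q \<circ> p = q" "p \<noteq> id"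
  obtains m where "m \<in> {2, 3}" "p ^^ m = id" "\<And>i. \<exists>n. q i = (p ^^ n) i"
  using assms(1,4)
proof (cases rule: perm_3_cases)
  case three_cycle
  then show thesis
    by (intro that[of 3]) auto
next
  case (transposition i j k)
  have cases: "l = i \<or> l = j \<or> l = k" for l
    using transposition(1) by auto
  have "p (q k) = q k"
    using fun_cong[OF assms(3), of k] transposition(4) by simp
  then have qk: "q k = k"
    using cases[of "q k"] transposition by auto
  have "q l = l \<or> q l = p l" for l
  proof (cases "l = k")
    case False
    then have "q l \<noteq> k"
      using qk bij_is_inj[OF assms(2)] by (metis injD)
    then show ?thesis
      using False cases[of l] cases[of "q l"] transposition(2,3) by auto
  qed (simp add: qk)
  then have "q l = (p ^^ 0) l \<or> q l = (p ^^ 1) l" for l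
    by simp
  then have "\<exists>n. q l = (p ^^ n) l" for l
    by blast
  moreover have "p (p l) = l" for l
    using cases[of l] transposition(2-4) by auto
  then have "p ^^ 2 = id"
    by (simp add: numeral_2_eq_2 fun_eq_iff)
  ultimately show thesis
    by (intro that[of 2]) auto
qed

lemma carrier_BijGroup_UNIV: "carrier (BijGroup UNIV) = Collect bij"
  by (auto simp: BijGroup_def Bij_def)

lemma mult_BijGroup_UNIV:
  assumes "bij p" "bij q"
  shows "p \<otimes>\<^bsub>BijGroup UNIV\<^esub> q = p \<circ> q"
  using assms by (auto simp: BijGroup_def Bij_def compose_def)

text \<open>The affine maps \<open>i \<mapsto> \<plusminus>i + b\<close> are all the permutations of \<open>\<int>/3\<close>.\<close>

lemma solvable_BijGroup_3: "solvable (BijGroup (UNIV :: 3 set))"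
proof -
  interpret unit_group "{1, -1 :: 3}"
    by unfold_locales auto
  let ?h = "\<lambda>(a :: 3, b :: 3). \<lambda>i. a * i + b"
  have *: "bij (?h x)" if "x \<in> {1, -1} \<times> UNIV" for x
  proof -
    have "inj (\<lambda>i :: 3. a * i + b)" if "a \<in> {1, -1}" for a b
      using that by (auto intro!: injI)
    then show ?thesis
      using that by (auto simp: bij_def finite_UNIV_inj_surj)
  qed
  interpret group_hom "affine_group {1, -1 :: 3}" "BijGroup (UNIV :: 3 set)" ?h
  proof -
    have "?h (x \<otimes>\<^bsub>affine_group {1, -1}\<^esub> y) = ?h x \<otimes>\<^bsub>BijGroup UNIV\<^esub> ?h y"
      if "x \<in> {1, -1} \<times> UNIV" "y \<in> {1, -1} \<times> UNIV" for x y
      unfolding mult_BijGroup_UNIV[OF *[OF that(1)] *[OF that(2)]]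
      by (cases x; cases y) (simp add: mult_affine fun_eq_iff algebra_simps)
    then have "?h \<in> hom (affine_group {1, -1}) (BijGroup UNIV)"
      using * by (intro homI) (simp_all only: carrier_BijGroup_UNIV carrier_affine mem_Collect_eq)
    then show "group_hom (affine_group {1, -1 :: 3}) (BijGroup (UNIV :: 3 set)) ?h"
      by (simp add: group_hom_def group_hom_axioms_def group_BijGroup affine.is_group)
  qed
  have "p \<in> ?h ` ({1, -1} \<times> UNIV)" if "bij p" for p :: "3 \<Rightarrow> 3"
  proof -
    have "p 0 \<noteq> p 1" "p 0 \<noteq> p 2" "p 1 \<noteq> p 2"
      using bij_is_inj[OF that] by (auto simp: inj_eq)
    moreover have "p i = 0 \<or> p i = 1 \<or> p i = 2" for i
      using UNIV_3_eq by auto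
    moreover note this[of 0] this[of 1] this[of 2]
    \<comment> \<open>The slope \<open>p 1 - p 0\<close> is nonzero by injectivity, and the two
      values \<open>p 0\<close> and \<open>p 1\<close> leave only one possibility for
      \<open>p 2\<close>.\<close>
    ultimately have *: "p 1 - p 0 \<in> {1, -1}" "p 2 = (p 1 - p 0) * 2 + p 0"
      by (elim disjE; simp)+
    have "p = ?h (p 1 - p 0, p 0)"
    proof
      fix i :: 3
      consider "i = 0" | "i = 1" | "i = 2"
        using UNIV_3_eq by auto
      then show "p i = ?h (p 1 - p 0, p 0) i"
        using *(2) by cases simp_all
    qed
    then show ?thesis
      by (rule image_eqI) (use *(1) in simp)
  qed
  then have "?h ` carrier (affine_group {1, -1}) = carrier (BijGroup UNIV)"
    using * unfolding carrier_affine carrier_BijGroup_UNIV by blast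
  then show ?thesis
    by (rule surj_hom_imp_solvable) (rule solvable_affine)
qed

section \<open>Wreath products\<close>

text \<open>
  The pair \<open>(p, f)\<close> stands for the monomial matrix whose only nonzero entry in column \<open>i\<close> is \<open>f i\<close>,
  in row \<open>p i\<close>; the multiplication is that of matrices.
\<close>

definition wreath :: "('a, 'b) monoid_scheme \<Rightarrow> (('i \<Rightarrow> 'i) \<times> ('i \<Rightarrow> 'a)) monoid" where
  "wreath F =
     \<lparr> carrier = Collect bij \<times> (UNIV \<rightarrow> carrier F),
       monoid.mult = (\<lambda>(p, f) (q, g). (p \<circ> q, \<lambda>i. f (q i) \<otimes>\<^bsub>F\<^esub> g i)),
       monoid.one = (id, \<lambda>_. \<one>\<^bsub>F\<^esub>) \<rparr>"

lemma wreath_simps: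
  "(p, f) \<in> carrier (wreath F) \<longleftrightarrow> bij p \<and> (\<forall>i. f i \<in> carrier F)"
  "(p, f) \<otimes>\<^bsub>wreath F\<^esub> (q, g) = (p \<circ> q, \<lambda>i. f (q i) \<otimes>\<^bsub>F\<^esub> g i)"
  "\<one>\<^bsub>wreath F\<^esub> = (id, \<lambda>_. \<one>\<^bsub>F\<^esub>)"
  by (auto simp: wreath_def)

lemma carrier_wreath: "carrier (wreath F) = Collect bij \<times> (UNIV \<rightarrow> carrier F)"
  by (simp add: wreath_def)

lemma finite_wreath:
  assumes "finite (carrier F)"
  shows "finite (carrier (wreath F :: (('i::finite \<Rightarrow> 'i) \<times> ('i \<Rightarrow> 'a)) monoid))"
proof -
  have "finite ((UNIV :: 'i set) \<rightarrow>\<^sub>E carrier F)"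
    using assms by (intro finite_PiE) auto
  then show ?thesis
    by (simp add: carrier_wreath PiE_UNIV_domain)
qed

context group
begin

lemma wreath_group: "group (wreath G)"
proof (rule groupI)
  fix x :: "('i \<Rightarrow> 'i) \<times> ('i \<Rightarrow> 'a)" assume "x \<in> carrier (wreath G)"
  then obtain p f where x: "x = (p, f)" "bij p" "\<And>i. f i \<in> carrier G"
    by (cases x) (auto simp: wreath_simps)
  let ?q = "Hilbert_Choice.inv p"
  have "(?q, \<lambda>i. inv (f (?q i))) \<in> carrier (wreath G)"
    using x by (auto simp: wreath_simps bij_imp_bij_inv)
  moreover have "(?q, \<lambda>i. inv (f (?q i))) \<otimes>\<^bsub>wreath G\<^esub> x = \<one>\<^bsub>wreath G\<^esub>"
    using x by (auto simp: wreath_simps bij_is_inj)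
  ultimately show "\<exists>y\<in>carrier (wreath G). y \<otimes>\<^bsub>wreath G\<^esub> x = \<one>\<^bsub>wreath G\<^esub>"
    by blast
qed (auto simp: wreath_simps m_assoc bij_comp comp_assoc intro!: m_closed)

lemma pow_wreath_fst:
  "fst (x [^]\<^bsub>wreath G\<^esub> (n::nat)) = fst x ^^ n"
proof (induction n)
  case (Suc n)
  then show ?case
    by (cases x; cases "x [^]\<^bsub>wreath G\<^esub> n") (simp add: wreath_simps funpow_swap1 fun_eq_iff)
qed (simp add: wreath_simps)

lemma pow_wreath_base:
  "(id, f) [^]\<^bsub>wreath G\<^esub> (n::nat) = (id, \<lambda>i. f i [^] n)"
  by (induction n) (simp_all add: wreath_simps fun_eq_iff)

text \<open>The base group is the kernel of the projection to permutations, so the wreath product is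
  an extension of two solvable groups. The base is solvable because its derived series is contained,
  term by term, in the power of the derived series of \<open>G\<close>.\<close>

lemma solvable_wreath:
  assumes "solvable G" "solvable (BijGroup (UNIV :: 'i set))"
  shows "solvable (wreath G :: (('i \<Rightarrow> 'i) \<times> ('i \<Rightarrow> 'a)) monoid)"
proof -
  let ?W = "wreath G :: (('i \<Rightarrow> 'i) \<times> ('i \<Rightarrow> 'a)) monoid"
  interpret W: group ?W
    by (rule wreath_group)
  define B :: "'a set \<Rightarrow> (('i \<Rightarrow> 'i) \<times> ('i \<Rightarrow> 'a)) set"
    where "B H = {id} \<times> (UNIV \<rightarrow> H)" for H
  have inv_base: "inv\<^bsub>?W\<^esub> (id, f) = (id, \<lambda>i. inv (f i))" if "f \<in> UNIV \<rightarrow> carrier G" for f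
    using that by (intro W.inv_equality) (auto simp: wreath_simps Pi_iff)
  have sub: "subgroup (B H) ?W" if "subgroup H G" for H
  proof -
    interpret H: subgroup H G by fact
    show ?thesis
      by unfold_locales (auto simp: B_def wreath_simps inv_base Pi_iff)
  qed
  have step: "derived ?W (B H) \<subseteq> B (derived G H)" if H: "subgroup H G" for H
  proof -
    interpret H: subgroup H G by fact
    have "h1 \<otimes> h2 \<otimes> inv h1 \<otimes> inv h2 \<in> derived G H" if "h1 \<in> H" "h2 \<in> H" for h1 h2
      using that unfolding derived_def by (blast intro: generate.incl)
    then show ?thesis
      unfolding derived_def[of ?W]
      by (intro W.generate_subgroup_incl[OF _ sub[OF derived_is_subgroup[OF H.subset]]])
         (auto simp: B_def wreath_simps inv_base Pi_iff)
  qed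
  have iter: "(derived ?W ^^ n) (B (carrier G)) \<subseteq> B ((derived G ^^ n) (carrier G))" for n
  proof (induction n)
    case (Suc n)
    then have "(derived ?W ^^ Suc n) (B (carrier G)) \<subseteq> derived ?W (B ((derived G ^^ n) (carrier G)))"
      by (simp add: W.mono_derived)
    also have "\<dots> \<subseteq> B ((derived G ^^ Suc n) (carrier G))"
      using step[OF exp_of_derived_is_subgroup[OF subgroup_self, of n]] by simp
    finally show ?case .
  qed simp
  obtain n where "(derived G ^^ n) (carrier G) = {\<one>}"
    using assms(1) solvable_iff_trivial_derived_seq by blast
  then have "(derived ?W ^^ n) (B (carrier G)) \<subseteq> {\<one>\<^bsub>?W\<^esub>}"
    using iter[of n] by (auto simp: B_def wreath_simps fun_eq_iff Pi_iff)
  then have "(derived ?W ^^ n) (B (carrier G)) = {\<one>\<^bsub>?W\<^esub>}"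
    using W.exp_of_derived_is_subgroup[OF sub[OF subgroup_self], of n] subgroup.one_closed by blast
  then have base: "solvable_seq ?W (B (carrier G))"
    using W.trivial_derived_seq_imp_solvable sub[OF subgroup_self] by blast
  have fst_hom: "group_hom ?W (BijGroup UNIV) fst"
    by (auto simp: group_hom_def group_hom_axioms_def hom_def group_BijGroup W.is_group
        carrier_wreath carrier_BijGroup_UNIV mult_BijGroup_UNIV wreath_simps)
  \<comment> \<open>The identity of the wreath product acts as the inclusion of the base group in
    the exact sequence.\<close>
  have id_hom: "group_hom ?W ?W (\<lambda>x. x)"
    by (auto simp: group_hom_def group_hom_axioms_def hom_def W.is_group)
  have "kernel ?W (BijGroup UNIV) fst \<subseteq> B (carrier G)"
    by (auto simp: kernel_def B_def carrier_wreath BijGroup_def fun_eq_iff)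
  moreover have "fst ` carrier ?W = carrier (BijGroup UNIV)"
    by (force simp: carrier_BijGroup_UNIV carrier_wreath)
  ultimately show ?thesis
    using solvable_seq_condition[OF id_hom fst_hom, of "B (carrier G)" "carrier ?W"]
      base assms(2) subgroup.subset[OF sub[OF subgroup_self]] W.subgroup_self
    by (simp add: solvable_def)
qed

text \<open>Entry \<open>i\<close> of the equation is
  \<open>c (q i) \<otimes> u i \<otimes> c i = u i\<close>, so \<open>u i\<close> is the conjugating
  element.\<close>

lemma wreath_base_inverted:
  assumes "(id, c) \<in> carrier (wreath G)" "(q, u) \<in> carrier (wreath G)"
    and "(id, c) \<otimes>\<^bsub>wreath G\<^esub> (q, u) \<otimes>\<^bsub>wreath G\<^esub> (id, c) = (q, u)"
  shows "conjugate (c (q i)) (inv (c i))"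
proof -
  have closed: "c j \<in> carrier G" "u j \<in> carrier G" for j
    using assms(1,2) by (auto simp: wreath_simps)
  have "c (q i) \<otimes> u i \<otimes> c i = u i"
    using assms(3) by (simp add: wreath_simps fun_eq_iff)
  then have "c (q i) \<otimes> u i = u i \<otimes> inv (c i)"
    using closed by (simp add: inv_solve_right)
  then show ?thesis
    using closed unfolding conjugate_def by blast
qed

text \<open>Entry \<open>j\<close> of the equation conjugates \<open>c (p j)\<close> to
  \<open>c j\<close> by \<open>f j\<close>; iterating follows the \<open>p\<close>-orbit. This is
  meant for a base element that is a power of \<open>(p, f)\<close>.\<close>

lemma wreath_base_centralized:
  assumes "(id, c) \<in> carrier (wreath G)" "(p, f) \<in> carrier (wreath G)"
    and "(id, c) \<otimes>\<^bsub>wreath G\<^esub> (p, f) = (p, f) \<otimes>\<^bsub>wreath G\<^esub> (id, c)"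
  shows "conjugate (c ((p ^^ n) i)) (c i)"
proof (induction n)
  case 0
  then show ?case
    using assms(1) by (simp add: wreath_simps conjugate_refl)
next
  case (Suc n)
  have "c (p j) \<otimes> f j = f j \<otimes> c j" for j
    using assms(3) by (simp add: wreath_simps fun_eq_iff)
  then have "conjugate (c (p j)) (c j)" for j
    using assms(1,2) unfolding conjugate_def by (auto simp: wreath_simps)
  with Suc show ?case
    using conjugate_trans by simp blast
qed

text \<open>Powers in the base are taken entrywise, and trivial entries impose no condition on an
  exponent.\<close>

lemma ord_wreath_base:
  assumes "(id, f) \<in> carrier (wreath G)" "a \<in> carrier G"
    and "\<And>i. f i = \<one> \<or> ord (f i) = ord a" "\<exists>i. ord (f i) = ord a"
  shows "group.ord (wreath G) (id, f) = ord a"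
proof -
  interpret W: group "wreath G"
    by (rule wreath_group)
  have "(id, f) [^]\<^bsub>wreath G\<^esub> n = \<one>\<^bsub>wreath G\<^esub> \<longleftrightarrow> a [^] n = \<one>" for n :: nat
  proof -
    have "(id, f) [^]\<^bsub>wreath G\<^esub> n = \<one>\<^bsub>wreath G\<^esub> \<longleftrightarrow> (\<forall>i. ord (f i) dvd n)"
      using assms(1) by (simp add: pow_wreath_base wreath_simps fun_eq_iff pow_eq_id)
    also have "\<dots> \<longleftrightarrow> ord a dvd n"
      using assms(3,4) by (metis ord_id one_dvd)
    finally show ?thesis
      using assms(2) by (simp add: pow_eq_id)
  qed
  then show ?thesis
    using assms(1,2) by (simp add: W.ord_unique pow_eq_id)
qed

theorem real_orders_wreath_3:
  assumes odd: "\<And>u. u \<in> carrier G \<Longrightarrow> odd (ord u)"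
  shows "real_orders (wreath G :: ((3 \<Rightarrow> 3) \<times> (3 \<Rightarrow> 'a)) monoid) = ord ` carrier G \<union> {2, 3}"
proof -
  let ?W = "wreath G :: ((3 \<Rightarrow> 3) \<times> (3 \<Rightarrow> 'a)) monoid"
  interpret W: group ?W
    by (rule wreath_group)
  have "W.ord x \<in> ord ` carrier G \<union> {2, 3}" if "real_element ?W x" for x
  proof -
    obtain p f q u where x: "x = (p, f)" and xW: "(p, f) \<in> carrier ?W"
      and yW: "(q, u) \<in> carrier ?W"
      and xyx: "(p, f) \<otimes>\<^bsub>?W\<^esub> (q, u) \<otimes>\<^bsub>?W\<^esub> (p, f) = (q, u)"
      using \<open>real_element ?W x\<close> unfolding W.real_element_iff by (metis surj_pair)
    have bij: "bij p" "bij q" and f: "\<And>i. f i \<in> carrier G"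
      using xW yW by (auto simp: wreath_simps)
    show ?thesis
    proof (cases "p = id")
      case True
      have inverted: "conjugate (f (q i)) (inv (f i))" for i
        by (rule wreath_base_inverted[OF xW[unfolded True] yW xyx[unfolded True]])
      have fixed: "f i = \<one>" if "q i = i" for i
        using inverted[of i] that conjugate_inv_odd odd by simp
      have trivial: ?thesis if "\<And>i. f i = \<one>"
      proof -
        have "x = \<one>\<^bsub>?W\<^esub>"
          using x True that by (simp add: wreath_simps fun_eq_iff)
        then have "W.ord x = ord \<one>"
          by simp
        then show ?thesis
          by blast
      qed
      show ?thesis
      proof (cases "q = id")
        case True
        then show ?thesis
          using fixed trivial by simp
      next
        case False
        with bij(2) show ?thesis
        proof (cases rule: perm_3_cases)
          case three_cycle
          \<comment> \<open>Going once around the 3-cycle inverts the conjugacy class an odd number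
            of times, so \<open>f i\<close> is conjugate to its own inverse.\<close>
          have "f i = \<one>" for i
          proof -
            have "q (q (q i)) = i"
              using fun_cong[OF three_cycle(1), of i] by (simp add: numeral_3_eq_3)
            moreover have "conjugate (inv (f (q i))) (f i)"
              using conjugate_inv[OF inverted[of i]] f by simp
            ultimately have "conjugate (f i) (inv (f i))"
              using inverted[of "q (q i)"] conjugate_inv[OF inverted[of "q i"]] inverted[of i] f
                conjugate_trans by (metis inv_inv)
            then show ?thesis
              using conjugate_inv_odd odd by blast
          qed
          then show ?thesis
            by (rule trivial)
        next
          case (transposition i j k)
          \<comment> \<open>The entries exchanged by \<open>q\<close> have equal orders, since
            inversion and conjugation preserve the order, and the entry at the fixed point is
            trivial. So only the order of one entry remains.\<close>
          have "ord (f j) = ord (f i)"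
            using ord_conjugate[OF inverted[of i]] transposition(2) f by simp
          moreover have "f k = \<one>"
            using fixed transposition(4) by blast
          moreover have "l = i \<or> l = j \<or> l = k" for l
            using transposition(1) by auto
          ultimately have "W.ord (id, f) = ord (f i)"
            using xW f True by (intro ord_wreath_base) metis+
          then show ?thesis
            using x True f by blast
        qed
      qed
    next
      case False
      have "p \<circ> q \<circ> p = q"
        using xyx by (simp add: wreath_simps)
      with False bij obtain m where m: "m \<in> {2, 3}" "p ^^ m = id" "\<And>i. \<exists>n. q i = (p ^^ n) i"
        by (metis perm_3_inverted)
      \<comment> \<open>Since \<open>p ^^ m = id\<close>, the power lies in the base group. It
        commutes with \<open>(p, f)\<close> and is inverted by \<open>(q, u)\<close>, so each
        \<open>c i\<close> is conjugate to \<open>c (q i)\<close> and hence to its own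
        inverse.\<close>
      obtain c where c: "(p, f) [^]\<^bsub>?W\<^esub> m = (id, c)"
        using pow_wreath_fst[of "(p, f)" m] m(2) by (metis fst_conv prod.collapse)
      then have cW: "(id, c) \<in> carrier ?W"
        using W.nat_pow_closed[OF xW, of m] by simp
      have "c i = \<one>" for i
      proof -
        have "(id, c) \<otimes>\<^bsub>?W\<^esub> (p, f) = (p, f) \<otimes>\<^bsub>?W\<^esub> (id, c)"
          using W.nat_pow_Suc2[OF xW, of m] by (simp add: c)
        moreover obtain n where "q i = (p ^^ n) i"
          using m(3) by blast
        ultimately have "conjugate (c i) (c (q i))"
          using wreath_base_centralized[OF cW xW] conjugate_sym by simp
        moreover have "conjugate (c (q i)) (inv (c i))"
          using wreath_base_inverted[OF cW yW] W.inverted_pow[OF xW yW xyx, of m] by (simp add: c)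
        ultimately show ?thesis
          using conjugate_trans conjugate_inv_odd odd by blast
      qed
      then have "(p, f) [^]\<^bsub>?W\<^esub> m = \<one>\<^bsub>?W\<^esub>"
        by (simp add: c wreath_simps fun_eq_iff)
      moreover have "(p, f) \<noteq> \<one>\<^bsub>?W\<^esub>"
        using False by (simp add: wreath_simps)
      moreover have "Factorial_Ring.prime m"
        using m(1) by auto
      ultimately have "W.ord x = m"
        unfolding x by (intro W.ord_eq_prime[OF xW])
      with m(1) show ?thesis
        by blast
    qed
  qed
  moreover have "ord a \<in> real_orders ?W" if a: "a \<in> carrier G" for a
  proof -
    \<comment> \<open>Modulo 3 the map \<open>?t\<close> exchanges 0 and 1 and fixes 2, so
      conjugating by it swaps the entries \<open>a\<close> and \<open>inv a\<close>, which inverts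
      the base element.\<close>
    let ?f = "\<lambda>i :: 3. if i = 0 then a else if i = 1 then inv a else \<one>"
    let ?t = "\<lambda>i :: 3. 1 - i"
    have t: "(?t, \<lambda>_. \<one>) \<in> carrier ?W"
      by (auto simp: wreath_simps intro!: o_bij[of ?t])
    have f: "(id, ?f) \<in> carrier ?W"
      using a by (auto simp: wreath_simps)
    have "(id, ?f) \<otimes>\<^bsub>?W\<^esub> (?t, \<lambda>_. \<one>) \<otimes>\<^bsub>?W\<^esub> (id, ?f) = (?t, \<lambda>_. \<one>)"
      using a by (auto simp: wreath_simps fun_eq_iff)
    with t f have "real_element ?W (id, ?f)"
      unfolding W.real_element_iff by blast
    moreover have "W.ord (id, ?f) = ord a"
      using f a by (intro ord_wreath_base) (auto intro!: exI[of _ "0 :: 3"])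
    ultimately show ?thesis
      by (rule real_ordersI)
  qed
  moreover have "2 \<in> real_orders ?W"
  proof -
    let ?t = "\<lambda>i :: 3. 1 - i"
    let ?x = "(?t, \<lambda>_ :: 3. \<one>)"
    have x: "?x \<in> carrier ?W"
      by (auto simp: wreath_simps intro!: o_bij[of ?t])
    have xx: "?x \<otimes>\<^bsub>?W\<^esub> ?x = \<one>\<^bsub>?W\<^esub>"
      by (simp add: wreath_simps fun_eq_iff)
    \<comment> \<open>An involution is its own inverse, so the identity already inverts it.\<close>
    with x have "real_element ?W ?x"
      unfolding W.real_element_iff by (auto intro!: bexI[of _ "\<one>\<^bsub>?W\<^esub>"])
    moreover have "?t \<noteq> id"
    proof
      assume "?t = id"
      from fun_cong[OF this, of 0] show False
        by simp
    qed
    then have "?x \<noteq> \<one>\<^bsub>?W\<^esub>"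
      by (simp only: wreath_simps prod.inject simp_thms not_False_eq_True)
    then have "W.ord ?x = 2"
    proof (rule W.ord_eq_prime[OF x])
      show "?x [^]\<^bsub>?W\<^esub> (2::nat) = \<one>\<^bsub>?W\<^esub>"
        using x xx by (simp add: numeral_2_eq_2)
    qed simp
    ultimately show ?thesis
      by (rule real_ordersI)
  qed
  moreover have "3 \<in> real_orders ?W"
  proof -
    \<comment> \<open>Rotation and reflection of three points: negation turns \<open>i + 1\<close>
      into its inverse \<open>i - 1\<close>.\<close>
    let ?s = "\<lambda>i :: 3. i + 1"
    let ?x = "(?s, \<lambda>_ :: 3. \<one>)"
    let ?y = "(uminus :: 3 \<Rightarrow> 3, \<lambda>_ :: 3. \<one>)"
    have x: "?x \<in> carrier ?W"
      by (auto simp: wreath_simps fun_eq_iff intro!: o_bij[of "\<lambda>i. i - 1"])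
    have y: "?y \<in> carrier ?W"
      by (auto simp: wreath_simps fun_eq_iff intro!: o_bij[of uminus])
    have "?x \<otimes>\<^bsub>?W\<^esub> ?y \<otimes>\<^bsub>?W\<^esub> ?x = ?y"
      by (simp add: wreath_simps fun_eq_iff)
    with x y have "real_element ?W ?x"
      unfolding W.real_element_iff by blast
    moreover have "?s \<noteq> id"
    proof
      assume "?s = id"
      from fun_cong[OF this, of 0] show False
        by simp
    qed
    then have "?x \<noteq> \<one>\<^bsub>?W\<^esub>"
      by (simp only: wreath_simps prod.inject simp_thms not_False_eq_True)
    moreover have "?x [^]\<^bsub>?W\<^esub> (3::nat) = \<one>\<^bsub>?W\<^esub>"
      by (simp add: numeral_3_eq_3 wreath_simps fun_eq_iff)
    ultimately have "real_element ?W ?x" "W.ord ?x = 3"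
      using x by (auto intro!: W.ord_eq_prime)
    then show ?thesis
      by (rule real_ordersI)
  qed
  ultimately show ?thesis
    unfolding real_orders_def by blast
qed

end

section \<open>The two groups\<close>

text \<open>The element orders are odd, so the real orders of the wreath product are
  \<open>1\<close>, \<open>2\<close>, \<open>3\<close> and the primes in \<open>P\<close>. The count
  is the cardinality of a union because \<open>P\<close> may contain \<open>3\<close>.\<close>

lemma (in group) wreath_3_nat_copy:
  assumes "finite (carrier G)" "solvable G" "ord ` carrier G = insert 1 P"
    and P: "finite P" "\<And>p. p \<in> P \<Longrightarrow> Factorial_Ring.prime p" "2 \<notin> P"
  obtains K :: "nat monoid"
  where "group K" "finite (carrier K)" "solvable K"
    "num_components (real_prime_graph K) = card ({2, 3} \<union> P)"
proof -
  have "odd (ord u)" if "u \<in> carrier G" for u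
  proof -
    have "ord u = 1 \<or> ord u \<in> P"
      using assms(3) that by blast
    then show ?thesis
      using P(2,3) by (metis odd_one primes_dvd_imp_eq two_is_prime_nat)
  qed
  then have orders: "real_orders (wreath G :: ((3 \<Rightarrow> 3) \<times> (3 \<Rightarrow> 'a)) monoid) = insert 1 ({2, 3} \<union> P)"
    using real_orders_wreath_3 assms(3) by auto
  obtain K :: "nat monoid" where K: "group K" "finite (carrier K)" "solvable K"
    and "real_orders K = real_orders (wreath G :: ((3 \<Rightarrow> 3) \<times> (3 \<Rightarrow> 'a)) monoid)"
    using finite_group_nat_copy[OF wreath_group finite_wreath[OF assms(1)]
        solvable_wreath[OF assms(2) solvable_BijGroup_3]] .
  with orders have "num_components (real_prime_graph K) = card ({2, 3} \<union> P)"
    using P(1,2) by (intro num_components_prime_real_orders) auto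
  with K show thesis
    by (rule that)
qed

lemma unit_group_one: "unit_group {1}"
  by unfold_locales auto

text \<open>With trivial linear part only translations remain, so this is the cyclic group of order
  5.\<close>

lemma orders_affine_5:
  "group.ord (affine_group {1 :: 5}) ` carrier (affine_group {1}) = {1, 5}"
proof -
  interpret unit_group "{1 :: 5}"
    by (rule unit_group_one)
  have five: "(5 :: 5) = 0"
    by simp
  have ord: "affine.ord (1, b) = 5" if "b \<noteq> 0" for b :: 5
    by (rule affine.ord_eq_prime) (use that in \<open>simp_all add: affine_simps pow_affine five\<close>)
  have "affine.ord x = 1 \<or> affine.ord x = 5" if x: "x \<in> carrier (affine_group {1})" for x
  proof -
    obtain b where "x = (1, b)"
      using x by (auto simp: affine_simps)
    then show ?thesis
      using ord[of b] affine.ord_id by (cases "b = 0") (auto simp: affine_simps)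
  qed
  then have "affine.ord ` carrier (affine_group {1 :: 5}) \<subseteq> {1, 5}"
    by blast
  moreover have "1 \<in> affine.ord ` carrier (affine_group {1 :: 5})"
    using imageI[OF affine.one_closed, of affine.ord] by simp
  moreover have "5 \<in> affine.ord ` carrier (affine_group {1 :: 5})"
    using imageI[of "(1, 1)" "carrier (affine_group {1 :: 5})" affine.ord]
    by (simp add: ord carrier_affine)
  ultimately show ?thesis
    by blast
qed

text \<open>These are the fifth roots of unity modulo \<open>11\<close>.\<close>

lemma unit_group_quintic: "unit_group {1, 3, 4, 5, 9 :: 11}"
proof
  fix a :: 11 assume "a \<in> {1, 3, 4, 5, 9}"
  then show "\<exists>b\<in>{1, 3, 4, 5, 9}. b * a = 1"
    by (elim insertE) auto
qed auto

text \<open>This is the Frobenius group of order 55. Nontrivial translations have order 11. If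
  \<open>a\<close> is not \<open>1\<close>, then \<open>a ^ 5 = 1\<close> makes the geometric sum of
  length 5 vanish, so the whole coset of translations has order 5.\<close>

lemma orders_affine_11:
  "group.ord (affine_group {1, 3, 4, 5, 9 :: 11}) ` carrier (affine_group {1, 3, 4, 5, 9}) = {1, 5, 11}"
proof -
  interpret unit_group "{1, 3, 4, 5, 9 :: 11}"
    by (rule unit_group_quintic)
  let ?A = "affine_group {1, 3, 4, 5, 9 :: 11}"
  have eleven: "(11 :: 11) = 0"
    by simp
  have translation: "affine.ord (1, b) = 11" if "b \<noteq> 0" for b :: 11
    by (rule affine.ord_eq_prime) (use that in \<open>simp_all add: affine_simps pow_affine eleven\<close>)
  have other: "affine.ord (a, b) = 5" if "a \<in> {3, 4, 5, 9}" for a b :: 11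
  proof (rule affine.ord_eq_prime)
    have "a ^ 5 = 1" "(\<Sum>i<5. a ^ i) = 0"
      using that by (auto simp: eval_nat_numeral)
    then show "(a, b) [^]\<^bsub>?A\<^esub> (5 :: nat) = \<one>\<^bsub>?A\<^esub>"
      by (simp add: pow_affine one_affine)
  qed (use that in \<open>auto simp: affine_simps\<close>)
  have "affine.ord x \<in> {1, 5, 11}" if x: "x \<in> carrier ?A" for x
  proof -
    obtain a b where "x = (a, b)" and "a = 1 \<or> a \<in> {3, 4, 5, 9}"
      using x by (auto simp: affine_simps)
    then show ?thesis
      using translation[of b] other[of a b] affine.ord_id by (cases "b = 0") (auto simp: affine_simps)
  qed
  then have "affine.ord ` carrier ?A \<subseteq> {1, 5, 11}"
    by blast
  moreover have "1 \<in> affine.ord ` carrier ?A"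
    using imageI[OF affine.one_closed, of affine.ord] by simp
  moreover have "5 \<in> affine.ord ` carrier ?A"
    using imageI[of "(3, 0)" "carrier ?A" affine.ord] by (simp add: other carrier_affine)
  moreover have "11 \<in> affine.ord ` carrier ?A"
    using imageI[of "(1, 1)" "carrier ?A" affine.ord] by (simp add: translation carrier_affine)
  ultimately show ?thesis
    by blast
qed

theorem theoremB:
  "\<exists>(G :: nat monoid) (H :: nat monoid).
     group G \<and> finite (carrier G) \<and> solvable G \<and> num_components (real_prime_graph G) = 3 \<and>
     group H \<and> finite (carrier H) \<and> solvable H \<and> num_components (real_prime_graph H) = 4"
proof -
  interpret C5: unit_group "{1 :: 5}"
    by (rule unit_group_one)
  interpret F55: unit_group "{1, 3, 4, 5, 9 :: 11}"
    by (rule unit_group_quintic)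
  \<comment> \<open>The wreath product over the cyclic group of order 5 gives the isolated vertices
    2, 3 and 5; the Frobenius group below adds the vertex 11.\<close>
  obtain G :: "nat monoid" where "group G" "finite (carrier G)" "solvable G"
    "num_components (real_prime_graph G) = card ({2, 3} \<union> {5 :: nat})"
    by (rule C5.affine.wreath_3_nat_copy[OF _ C5.solvable_affine orders_affine_5])
       (auto simp: C5.carrier_affine)
  moreover obtain H :: "nat monoid" where "group H" "finite (carrier H)" "solvable H"
    "num_components (real_prime_graph H) = card ({2, 3} \<union> {5, 11 :: nat})"
    by (rule F55.affine.wreath_3_nat_copy[OF _ F55.solvable_affine orders_affine_11])
       (auto simp: F55.carrier_affine)
  ultimately have "group G \<and> finite (carrier G) \<and> solvable G \<and> num_components (real_prime_graph G) = 3 \<and>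
     group H \<and> finite (carrier H) \<and> solvable H \<and> num_components (real_prime_graph H) = 4"
    by simp
  then show ?thesis
    by blast
qed

end
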